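(* Let $H$ be a real Hilbert space and let $A$ be a self-adjoint linear operator on $H$ with dense domain $D(A)$. Let $(u_0,u_1)\in D(A)\times D(A^{1/2})$, let $p\in[0,1]$, and let $m:[0,+\infty)\to(0,+\infty)$ be a locally Lipschitz continuous function. Assume that $$\inf\{m(\sigma):\sigma\ge 0\}>0,\qquad \inf\{\langle Au,u\rangle: u\in D(A),\ |u|=1\}>0 .$$ Let $\varepsilon>0$, and let $u_\varepsilon\in C^2([0,+\infty);H)\cap C^1([0,+\infty);D(A^{1/2}))\cap C^0([0,+\infty);D(A))$ be the (global) solution of $$\varepsilon u_\varepsilon''(t)+\frac{1}{(1+t)^p}u_\varepsilon'(t)+m\left(|A^{1/2}u_\varepsilon(t)|^2\right)Au_\varepsilon(t)=0\quad\forall t\ge 0,\qquad u_\varepsilon(0)=u_0,\quad u_\varepsilon'(0)=u_1.$$ Let $\Phi:[0,+\infty)\to(0,+\infty)$ be a function of class $C^1$ such that $$\lim_{t\to+\infty}(1+t)^p\,\frac{\Phi'(t)}{\Phi(t)}=-\infty .$$ If $(u_0,u_1)\ne(0,0)$, then $$\lim_{t\to+\infty}\left(\varepsilon|u_\varepsilon'(t)|^2+|A^{1/2}u_\varepsilon(t)|^2\right)\frac{1}{\Phi(t)}=+\infty .$$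
   Context: $|x|$ and $\langle x,y\rangle$ denote the norm and scalar product of $H$. The operator $A$ may be unbounded; its powers $A^\alpha$ ($\alpha\ge 0$) are defined by the spectral theorem on domains $D(A^\alpha)$, endowed with the graph norm. *)

theory Defs
  imports "HOL-Analysis.Analysis"
begin

text \<open>An operator, possibly unbounded, is a pair \<open>D\<close>, \<open>A\<close> of a domain and a map; the values of
  \<open>A\<close> outside \<open>D\<close> are irrelevant.\<close>

definition densely_defined_operator ::
    "'a::real_inner set \<Rightarrow> ('a \<Rightarrow> 'a) \<Rightarrow> bool" where
  "densely_defined_operator D A \<longleftrightarrow>
     subspace D \<and> closure D = UNIV \<and>
     (\<forall>x\<in>D. \<forall>y\<in>D. A (x + y) = A x + A y) \<and>
     (\<forall>c. \<forall>x\<in>D. A (c *\<^sub>R x) = c *\<^sub>R A x)"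

definition adjoint_graph :: "'a::real_inner set \<Rightarrow> ('a \<Rightarrow> 'a) \<Rightarrow> ('a \<times> 'a) set" where
  "adjoint_graph D A = {(v, w). \<forall>x\<in>D. inner (A x) v = inner x w}"

definition self_adjoint_operator :: "'a::real_inner set \<Rightarrow> ('a \<Rightarrow> 'a) \<Rightarrow> bool" where
  "self_adjoint_operator D A \<longleftrightarrow>
     densely_defined_operator D A \<and> adjoint_graph D A = {(x, A x) | x. x \<in> D}"

definition orthogonal_projection :: "('a::real_inner \<Rightarrow> 'a) \<Rightarrow> bool" where
  "orthogonal_projection P \<longleftrightarrow>
     bounded_linear P \<and> (\<forall>x. P (P x) = P x) \<and> (\<forall>x y. inner (P x) y = inner x (P y))"

text \<open>Only the values on Borel sets are constrained; countable additivity is in the strong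
  operator topology.\<close>

definition projection_valued_measure :: "(real set \<Rightarrow> 'a::real_inner \<Rightarrow> 'a) \<Rightarrow> bool" where
  "projection_valued_measure E \<longleftrightarrow>
     (\<forall>S\<in>sets borel. orthogonal_projection (E S)) \<and>
     (\<forall>x. E UNIV x = x) \<and>
     (\<forall>S\<in>sets borel. \<forall>T\<in>sets borel. \<forall>x. E (S \<inter> T) x = E S (E T x)) \<and>
     (\<forall>F::nat \<Rightarrow> real set. range F \<subseteq> sets borel \<longrightarrow> disjoint_family F \<longrightarrow>
        (\<forall>x. (\<lambda>n. E (F n) x) sums E (\<Union>n. F n) x))"

definition scalar_measure :: "(real set \<Rightarrow> 'a::real_inner \<Rightarrow> 'a) \<Rightarrow> 'a \<Rightarrow> real measure" where
  "scalar_measure E x = measure_of UNIV (sets borel) (\<lambda>S. ennreal (inner (E S x) x))"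

definition spectral_domain ::
    "(real set \<Rightarrow> 'a::real_inner \<Rightarrow> 'a) \<Rightarrow> (real \<Rightarrow> real) \<Rightarrow> 'a set" where
  "spectral_domain E f = {x. (\<integral>\<^sup>+ l. ennreal ((f l)\<^sup>2) \<partial>scalar_measure E x) < \<infinity>}"

text \<open>The integral of \<open>f\<close> with respect to \<open>E\<close> is determined by
  \<open>\<langle>f(E) x, z\<rangle> = \<integral> f d\<langle>E x, z\<rangle>\<close>. The signed measure \<open>\<langle>E x, z\<rangle>\<close> is
  expressed through positive ones by polarization. The test vectors \<open>z\<close> range over the
  (dense) domain of \<open>f(E)\<close>, so that both integrals converge.\<close>

definition spectral_integral ::
    "(real set \<Rightarrow> 'a::real_inner \<Rightarrow> 'a) \<Rightarrow> (real \<Rightarrow> real) \<Rightarrow> 'a \<Rightarrow> 'a" where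
  "spectral_integral E f x =
     (THE y. \<forall>z\<in>spectral_domain E f.
        inner y z = ((\<integral>l. f l \<partial>scalar_measure E (x + z)) - (\<integral>l. f l \<partial>scalar_measure E (x - z))) / 4)"

text \<open>\<open>E\<close> is the spectral measure of \<open>A\<close>, i.e. \<open>A = \<integral> \<lambda> dE(\<lambda>)\<close> with equality of domains. By the
  spectral theorem every self-adjoint operator has exactly one (as a function on Borel sets).\<close>

definition spectral_measure_of ::
    "'a::real_inner set \<Rightarrow> ('a \<Rightarrow> 'a) \<Rightarrow> (real set \<Rightarrow> 'a \<Rightarrow> 'a) \<Rightarrow> bool" where
  "spectral_measure_of D A E \<longleftrightarrow>
     projection_valued_measure E \<and>
     D = spectral_domain E (\<lambda>l. l) \<and>
     (\<forall>x\<in>D. A x = spectral_integral E (\<lambda>l. l) x)"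

text \<open>Domain and action of the square root of \<open>A\<close>, for nonnegative \<open>A\<close> with spectral measure \<open>E\<close>. In that case
  \<open>E\<close> vanishes on the negative half-line, where the values of \<open>sqrt\<close> do not matter.\<close>

definition sqrt_domain :: "(real set \<Rightarrow> 'a::real_inner \<Rightarrow> 'a) \<Rightarrow> 'a set" where
  "sqrt_domain E = spectral_domain E sqrt"

definition sqrt_op :: "(real set \<Rightarrow> 'a::real_inner \<Rightarrow> 'a) \<Rightarrow> 'a \<Rightarrow> 'a" where
  "sqrt_op E = spectral_integral E sqrt"

definition graph_norm :: "('a::real_inner \<Rightarrow> 'a) \<Rightarrow> 'a \<Rightarrow> real" where
  "graph_norm B x = sqrt ((norm x)\<^sup>2 + (norm (B x))\<^sup>2)"

text \<open>Regularity of curves with values in \<open>D\<close>, endowed with the graph norm of \<open>B\<close>.\<close>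

definition C0_graph ::
    "'a::real_inner set \<Rightarrow> ('a \<Rightarrow> 'a) \<Rightarrow> real set \<Rightarrow> (real \<Rightarrow> 'a) \<Rightarrow> bool" where
  "C0_graph D B I f \<longleftrightarrow>
     (\<forall>t\<in>I. f t \<in> D) \<and>
     (\<forall>t\<in>I. ((\<lambda>s. graph_norm B (f s - f t)) \<longlongrightarrow> 0) (at t within I))"

definition C1_graph ::
    "'a::real_inner set \<Rightarrow> ('a \<Rightarrow> 'a) \<Rightarrow> real set \<Rightarrow> (real \<Rightarrow> 'a) \<Rightarrow> bool" where
  "C1_graph D B I f \<longleftrightarrow>
     (\<forall>t\<in>I. f t \<in> D) \<and>
     (\<exists>g. C0_graph D B I g \<and>
        (\<forall>t\<in>I. ((\<lambda>s. graph_norm B ((f s - f t) /\<^sub>R (s - t) - g t)) \<longlongrightarrow> 0) (at t within I)))"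

end

theory Submission
  imports Defs
begin

text \<open>
  Let \<open>M\<close> be the primitive of \<open>m\<close> vanishing at \<open>0\<close>. Taking the scalar product of the equation
  with \<open>u'\<close> shows that the energy \<open>e = \<epsilon> |u'|\<^sup>2 + M(|A\<^sup>1\<^sup>/\<^sup>2 u|\<^sup>2)\<close> satisfies
  \<open>e' = - 2 |u'|\<^sup>2 / (1 + t)\<^sup>p \<ge> - (2/\<epsilon>) e / (1 + t)\<^sup>p\<close>. A weak damping can therefore dissipate
  the energy only at a rate proportional to \<open>(1 + t)\<^sup>-\<^sup>p\<close>, whereas the hypothesis on \<open>\<Phi>\<close> says that
  \<open>\<Phi>\<close> decays at a rate infinitely larger than this. Since \<open>p \<le> 1\<close>, a difference of rates
  of the order of \<open>(1 + t)\<^sup>-\<^sup>p\<close> already forces \<open>e / \<Phi>\<close> to infinity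
  (\<open>weakly_damped_over_weight_at_top\<close>). The energy is positive at time \<open>0\<close> because the data are
  nontrivial and \<open>A\<close> is coercive. Finally \<open>e\<close> decreases, so \<open>|A\<^sup>1\<^sup>/\<^sup>2 u|\<^sup>2\<close> is bounded, \<open>m\<close> is bounded
  on its range, and \<open>e\<close> is at most a constant times \<open>\<epsilon> |u'|\<^sup>2 + |A\<^sup>1\<^sup>/\<^sup>2 u|\<^sup>2\<close>.

  The energy identity needs \<open>|A\<^sup>1\<^sup>/\<^sup>2 x|\<^sup>2 = \<langle>A x, x\<rangle>\<close> on the domain of \<open>A\<close>
  (\<open>norm_sqrt_op\<close>). The square root is defined by a spectral integral, so most of the work
  consists in showing that spectral integrals exist and that
  \<open>|f(E) x|\<^sup>2 = \<integral> f\<^sup>2 d\<langle>E x, x\<rangle>\<close> and \<open>\<langle>f(E) x, x\<rangle> = \<integral> f d\<langle>E x, x\<rangle>\<close>. Both sides of the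
  identity are then integrals against the measure \<open>\<langle>E x, x\<rangle>\<close>, of \<open>|\<lambda>|\<close> (the square of the real
  \<open>sqrt\<close>, extended as an odd function) and of \<open>\<lambda>\<close>; coercivity removes the negative
  half-line. The derivative of \<open>\<langle>A u, u\<rangle>\<close> comes from the symmetry of \<open>A\<close>
  (\<open>quadratic_form_has_derivative\<close>).
\<close>

section \<open>The functional calculus on simple functions\<close>

text \<open>The graph of \<open>g \<mapsto> g(E) x\<close> on simple functions, as the linear span of the pairs
  \<open>(1\<^sub>S, E S x)\<close>. Taking pairs avoids showing that the sum representing
  \<open>g(E) x\<close> does not depend on how \<open>g\<close> is written.\<close>

inductive simple_calculus ::
    "(real set \<Rightarrow> 'a::real_inner \<Rightarrow> 'a) \<Rightarrow> 'a \<Rightarrow> (real \<Rightarrow> real) \<Rightarrow> 'a \<Rightarrow> bool"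
    for E :: "real set \<Rightarrow> 'a \<Rightarrow> 'a" and x :: 'a where
  zero: "simple_calculus E x (\<lambda>_. 0) 0"
| step: "simple_calculus E x g y \<Longrightarrow> S \<in> sets borel \<Longrightarrow>
    simple_calculus E x (\<lambda>l. g l + a * indicator S l) (y + a *\<^sub>R E S x)"

lemma simple_calculus_measurable:
  "simple_calculus E x g y \<Longrightarrow> g \<in> borel_measurable borel"
  by (induction rule: simple_calculus.induct) auto

lemma simple_calculus_bounded:
  "simple_calculus E x g y \<Longrightarrow> \<exists>B. \<forall>l. \<bar>g l\<bar> \<le> B"
proof (induction rule: simple_calculus.induct)
  case zero
  then show ?case by auto
next
  case (step g y S a)
  then obtain B where "\<And>l. \<bar>g l\<bar> \<le> B" by auto
  then have "\<bar>g l + a * indicator S l\<bar> \<le> B + \<bar>a\<bar>" for l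
    by (auto simp: indicator_def intro: order_trans[OF abs_triangle_ineq] add_mono)
      (metis abs_ge_zero add_increasing2)
  then show ?case by blast
qed

lemma simple_calculus_sum:
  assumes "finite I" "\<And>i. i \<in> I \<Longrightarrow> S i \<in> sets borel"
  shows "\<exists>y. simple_calculus E x (\<lambda>l. \<Sum>i\<in>I. a i * indicator (S i) l) y"
  using assms
proof (induction I)
  case empty
  then show ?case using simple_calculus.zero[of E x] by auto
next
  case (insert i I)
  then obtain y where "simple_calculus E x (\<lambda>l. \<Sum>i\<in>I. a i * indicator (S i) l) y"
    by auto
  from simple_calculus.step[OF this, of "S i" "a i"] insert.prems
  have "simple_calculus E x (\<lambda>l. (\<Sum>i\<in>I. a i * indicator (S i) l) + a i * indicator (S i) l)
      (y + a i *\<^sub>R E (S i) x)"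
    by blast
  also have "(\<lambda>l. (\<Sum>i\<in>I. a i * indicator (S i) l) + a i * indicator (S i) l)
      = (\<lambda>l. \<Sum>i\<in>insert i I. a i * indicator (S i) l)"
    unfolding sum.insert[OF insert.hyps] by (rule ext) (rule add.commute)
  finally show ?case ..
qed

lemma simple_calculus_exists:
  assumes "simple_function borel g"
  shows "\<exists>y. simple_calculus E x g y"
proof -
  have "g -` {v} \<in> sets borel" for v
    using simple_functionD(2)[OF assms, of "{v}"] by simp
  then have "\<exists>y. simple_calculus E x (\<lambda>l. \<Sum>v\<in>range g. v * indicator (g -` {v}) l) y"
    using simple_functionD(1)[OF assms] by (intro simple_calculus_sum) simp_all
  also have "(\<lambda>l. \<Sum>v\<in>range g. v * indicator (g -` {v}) l) = g"
  proof
    fix l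
    show "(\<Sum>v\<in>range g. v * indicator (g -` {v}) l) = g l"
      using simple_function_indicator_representation_banach[OF assms, of l]
      by (simp only: space_borel Int_UNIV_right real_scaleR_def mult.commute UNIV_I)
  qed
  finally show ?thesis .
qed

context
  fixes E :: "real set \<Rightarrow> 'a::{real_inner, complete_space} \<Rightarrow> 'a"
  assumes E: "projection_valued_measure E"
begin

section \<open>The measures attached to a projection-valued measure\<close>

lemma bounded_linear_pvm: "S \<in> sets borel \<Longrightarrow> bounded_linear (E S)"
  using E by (auto simp: projection_valued_measure_def orthogonal_projection_def)

lemma pvm_Int: "S \<in> sets borel \<Longrightarrow> T \<in> sets borel \<Longrightarrow> E S (E T x) = E (S \<inter> T) x"
  using E by (auto simp: projection_valued_measure_def)

lemma pvm_inner:
  assumes "S \<in> sets borel" "T \<in> sets borel"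
  shows "inner (E S x) (E T y) = inner (E (S \<inter> T) x) y"
proof -
  have "inner (E T (E S x)) y = inner (E S x) (E T y)"
    using E assms by (auto simp: projection_valued_measure_def orthogonal_projection_def)
  then show ?thesis
    using pvm_Int[OF assms(2,1)] by (simp add: Int_commute)
qed

lemma pvm_inner_self: "S \<in> sets borel \<Longrightarrow> inner (E S x) x = (norm (E S x))\<^sup>2"
  using pvm_inner[of S S x x] by (simp add: power2_norm_eq_inner)

lemma pvm_UNIV: "E UNIV x = x"
  using E by (auto simp: projection_valued_measure_def)

lemma pvm_sums:
  "range F \<subseteq> sets borel \<Longrightarrow> disjoint_family F \<Longrightarrow> (\<lambda>n. E (F n) x) sums E (\<Union>n. F n) x"
  using E by (auto simp: projection_valued_measure_def)

lemma pvm_empty: "E {} x = 0"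
proof -
  have "(\<lambda>n::nat. E {} x) sums E {} x"
    using pvm_sums[of "\<lambda>_. {}" x] by (simp add: disjoint_family_on_def)
  then show ?thesis
    by (metis sums_summable summable_const_iff)
qed

lemma sets_scalar_measure [simp]: "sets (scalar_measure E x) = sets borel"
  unfolding scalar_measure_def
  by (rule sigma_algebra.sets_measure_of_eq) (metis sets.sigma_algebra_axioms space_borel)

lemma space_scalar_measure [simp]: "space (scalar_measure E x) = UNIV"
  by (simp add: scalar_measure_def)

lemma measurable_scalar_measure [simp]:
  "borel_measurable (scalar_measure E x) = borel_measurable borel"
  by (rule measurable_cong_sets) simp_all

lemma emeasure_scalar_measure:
  assumes "S \<in> sets borel"
  shows "emeasure (scalar_measure E x) S = ennreal ((norm (E S x))\<^sup>2)"
proof -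
  let ?\<mu> = "\<lambda>S. ennreal (inner (E S x) x)"
  have "measure_space UNIV (sets borel) ?\<mu>"
    unfolding measure_space_def
  proof (intro conjI)
    show "sigma_algebra UNIV (sets (borel :: real measure))"
      by (metis sets.sigma_algebra_axioms space_borel)
    show "positive (sets borel) ?\<mu>"
      by (simp add: positive_def pvm_empty)
    show "countably_additive (sets borel) ?\<mu>"
    proof (rule countably_additiveI)
      fix F :: "nat \<Rightarrow> real set"
      assume F: "range F \<subseteq> sets borel" "disjoint_family F"
      have "(\<lambda>n. inner (E (F n) x) x) sums inner (E (\<Union>n. F n) x) x"
        by (rule bounded_linear.sums[OF bounded_linear_inner_left pvm_sums[OF F]])
      then have sums: "summable (\<lambda>n. inner (E (F n) x) x)"
          "(\<Sum>n. inner (E (F n) x) x) = inner (E (\<Union>n. F n) x) x"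
        by (simp_all only: sums_iff)
      have "0 \<le> inner (E (F n) x) x" for n
        using F(1) by (subst pvm_inner_self) auto
      from suminf_ennreal2[OF this sums(1)] show "(\<Sum>n. ?\<mu> (F n)) = ?\<mu> (\<Union>n. F n)"
        unfolding sums(2) .
    qed
  qed
  then have "emeasure (scalar_measure E x) S = ?\<mu> S"
    unfolding scalar_measure_def measure_space_def
    by (intro emeasure_measure_of_sigma assms) (elim conjE, assumption)+
  then show ?thesis
    by (simp add: pvm_inner_self assms)
qed

lemma finite_scalar_measure: "finite_measure (scalar_measure E x)"
  by (rule finite_measureI) (simp add: emeasure_scalar_measure)

lemma measure_scalar_measure:
  "S \<in> sets borel \<Longrightarrow> measure (scalar_measure E x) S = (norm (E S x))\<^sup>2"
  by (simp add: measure_def emeasure_scalar_measure)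

lemma AE_scalar_measure:
  assumes "{l. P l} \<in> sets borel" "E {l. \<not> P l} x = 0"
  shows "AE l in scalar_measure E x. P l"
proof (rule AE_I)
  have "{l. \<not> P l} = UNIV - {l. P l}" by auto
  then have m: "{l. \<not> P l} \<in> sets borel" using assms(1) by (metis borel_comp Compl_eq_Diff_UNIV)
  then show "{l. \<not> P l} \<in> sets (scalar_measure E x)" by simp
  show "emeasure (scalar_measure E x) {l. \<not> P l} = 0"
    using m assms by (simp add: emeasure_scalar_measure)
qed auto

text \<open>The measures of \<open>x + z\<close> are dominated by those of \<open>x\<close> and \<open>z\<close>, because
  \<open>|a + b|\<^sup>2 \<le> 2|a|\<^sup>2 + 2|b|\<^sup>2\<close>; hence spectral domains are closed under addition.\<close>

lemma nn_integral_scalar_measure_add_le: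
  fixes g :: "real \<Rightarrow> ennreal"
  assumes "g \<in> borel_measurable borel"
  shows "(\<integral>\<^sup>+ l. g l \<partial>scalar_measure E (x + z)) \<le>
    2 * (\<integral>\<^sup>+ l. g l \<partial>scalar_measure E x) + 2 * (\<integral>\<^sup>+ l. g l \<partial>scalar_measure E z)"
  using assms
proof (induction rule: borel_measurable_induct)
  case (cong f g)
  then show ?case by (simp cong: nn_integral_cong)
next
  case (set S)
  have "(norm (E S (x + z)))\<^sup>2 \<le> 2 * (norm (E S x))\<^sup>2 + 2 * (norm (E S z))\<^sup>2"
  proof -
    have "norm (E S (x + z)) \<le> norm (E S x) + norm (E S z)"
      using bounded_linear_pvm[OF set]
      by (simp add: linear_add bounded_linear.linear norm_triangle_ineq)
    then have "(norm (E S (x + z)))\<^sup>2 \<le> (norm (E S x) + norm (E S z))\<^sup>2"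
      by (rule power_mono) simp
    also have "\<dots> \<le> 2 * (norm (E S x))\<^sup>2 + 2 * (norm (E S z))\<^sup>2"
      using sum_squares_bound[of "norm (E S x)" "norm (E S z)"] by (simp add: power2_sum)
    finally show ?thesis .
  qed
  then have "ennreal ((norm (E S (x + z)))\<^sup>2)
      \<le> 2 * ennreal ((norm (E S x))\<^sup>2) + 2 * ennreal ((norm (E S z))\<^sup>2)"
    by (simp add: ennreal_mult[symmetric] ennreal_plus[symmetric] ennreal_leI
          flip: ennreal_numeral del: ennreal_plus)
  then show ?case
    using set by (simp add: emeasure_scalar_measure)
next
  case (mult u c)
  have "c * (\<integral>\<^sup>+ l. u l \<partial>scalar_measure E (x + z))
      \<le> c * (2 * (\<integral>\<^sup>+ l. u l \<partial>scalar_measure E x) + 2 * (\<integral>\<^sup>+ l. u l \<partial>scalar_measure E z))"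
    by (rule mult_left_mono[OF mult.IH]) simp
  then show ?case
    using mult.hyps by (simp add: nn_integral_cmult distrib_left mult.left_commute)
next
  case (add u v)
  have "(\<integral>\<^sup>+ l. u l \<partial>scalar_measure E (x + z)) + (\<integral>\<^sup>+ l. v l \<partial>scalar_measure E (x + z))
      \<le> (2 * (\<integral>\<^sup>+ l. u l \<partial>scalar_measure E x) + 2 * (\<integral>\<^sup>+ l. u l \<partial>scalar_measure E z))
        + (2 * (\<integral>\<^sup>+ l. v l \<partial>scalar_measure E x) + 2 * (\<integral>\<^sup>+ l. v l \<partial>scalar_measure E z))"
    by (rule add_mono[OF add.IH])
  then show ?case
    using add.hyps by (simp add: nn_integral_add distrib_left add_ac)
next
  case (seq U)
  have U: "U i \<in> borel_measurable borel" for i using seq by simp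
  have sup: "(\<integral>\<^sup>+ l. (SUP i. U i) l \<partial>scalar_measure E w) = (SUP i. \<integral>\<^sup>+ l. U i l \<partial>scalar_measure E w)" for w
    unfolding SUP_apply using seq by (intro nn_integral_monotone_convergence_SUP) auto
  have le: "(\<integral>\<^sup>+ l. U i l \<partial>scalar_measure E w) \<le> (SUP i. \<integral>\<^sup>+ l. U i l \<partial>scalar_measure E w)" for i w
    by (rule SUP_upper) simp
  show ?case
    unfolding sup
  proof (rule SUP_least)
    fix i
    have "(\<integral>\<^sup>+ l. U i l \<partial>scalar_measure E (x + z)) \<le>
       2 * (\<integral>\<^sup>+ l. U i l \<partial>scalar_measure E x) + 2 * (\<integral>\<^sup>+ l. U i l \<partial>scalar_measure E z)"
      by (rule seq.IH)
    also have "\<dots> \<le> 2 * (SUP i. \<integral>\<^sup>+ l. U i l \<partial>scalar_measure E x)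
        + 2 * (SUP i. \<integral>\<^sup>+ l. U i l \<partial>scalar_measure E z)"
      by (intro add_mono mult_left_mono le) simp_all
    finally show "(\<integral>\<^sup>+ l. U i l \<partial>scalar_measure E (x + z)) \<le> \<dots>" .
  qed
qed

lemma scalar_measure_minus: "scalar_measure E (- x) = scalar_measure E x"
  by (rule measure_eqI)
    (simp_all add: emeasure_scalar_measure linear_neg bounded_linear.linear bounded_linear_pvm)

lemma spectral_domain_add:
  assumes "f \<in> borel_measurable borel" "x \<in> spectral_domain E f" "z \<in> spectral_domain E f"
  shows "x + z \<in> spectral_domain E f"
  using assms nn_integral_scalar_measure_add_le[of "\<lambda>l. ennreal ((f l)\<^sup>2)" x z]
  by (auto simp: spectral_domain_def ennreal_mult_less_top intro: le_less_trans)

lemma spectral_domain_diff: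
  assumes "f \<in> borel_measurable borel" "x \<in> spectral_domain E f" "z \<in> spectral_domain E f"
  shows "x - z \<in> spectral_domain E f"
  using spectral_domain_add[of f x "- z"] assms
  by (simp add: spectral_domain_def scalar_measure_minus)

lemma integrable_square_spectral_domain:
  assumes "f \<in> borel_measurable borel" "x \<in> spectral_domain E f"
  shows "integrable (scalar_measure E x) (\<lambda>l. (f l)\<^sup>2)"
  using assms by (auto simp: integrable_iff_bounded spectral_domain_def)

lemma integrable_spectral_domain:
  assumes "f \<in> borel_measurable borel" "x \<in> spectral_domain E f"
  shows "integrable (scalar_measure E x) f"
  by (rule finite_measure.square_integrable_imp_integrable[OF finite_scalar_measure])
    (simp_all add: assms(1) integrable_square_spectral_domain[OF assms])

text \<open>The finite measure of \<open>E S x\<close> is concentrated on \<open>S\<close>, where \<open>f\<close> is bounded.\<close>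

lemma pvm_in_spectral_domain:
  assumes f: "f \<in> borel_measurable borel" and S: "S \<in> sets borel"
    and bound: "\<And>l. l \<in> S \<Longrightarrow> \<bar>f l\<bar> \<le> c"
  shows "E S x \<in> spectral_domain E f"
proof -
  have "AE l in scalar_measure E (E S x). l \<in> S"
    using S by (intro AE_scalar_measure) (auto simp: pvm_Int pvm_empty simp flip: Compl_eq)
  then have "AE l in scalar_measure E (E S x). ennreal ((f l)\<^sup>2) \<le> ennreal (c\<^sup>2)"
    by eventually_elim (intro ennreal_leI, use bound abs_le_square_iff in fastforce)
  then have "(\<integral>\<^sup>+ l. ennreal ((f l)\<^sup>2) \<partial>scalar_measure E (E S x))
      \<le> (\<integral>\<^sup>+ l. ennreal (c\<^sup>2) \<partial>scalar_measure E (E S x))"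
    by (rule nn_integral_mono_AE)
  also have "\<dots> < \<infinity>"
    by (simp add: emeasure_scalar_measure ennreal_mult_less_top)
  finally show ?thesis
    by (simp add: spectral_domain_def)
qed

section \<open>Existence of spectral integrals\<close>

lemma integrable_bounded:
  assumes "g \<in> borel_measurable borel" "\<exists>B. \<forall>l. \<bar>g l :: real\<bar> \<le> B"
  shows "integrable (scalar_measure E x) g"
proof -
  obtain B where "\<And>l. \<bar>g l\<bar> \<le> B" using assms(2) by auto
  then show ?thesis
    using assms(1)
    by (intro finite_measure.integrable_const_bound[OF finite_scalar_measure, of _ B])
      (simp_all add: measurable_scalar_measure)
qed

lemma integrable_indicator:
  "S \<in> sets borel \<Longrightarrow> integrable (scalar_measure E x) (indicat_real S)"
  by (rule integrable_real_indicator)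
    (simp_all add: sets_scalar_measure emeasure_scalar_measure)

lemma integrable_simple_calculus:
  "simple_calculus E x g y \<Longrightarrow> integrable (scalar_measure E w) g"
  by (intro integrable_bounded simple_calculus_measurable simple_calculus_bounded)

lemma integrable_simple_calculus_mult:
  assumes "simple_calculus E x g y" "simple_calculus E x' h z"
  shows "integrable (scalar_measure E w) (\<lambda>l. g l * h l)"
proof (rule integrable_bounded)
  obtain B C where "\<And>l. \<bar>g l\<bar> \<le> B" "\<And>l. \<bar>h l\<bar> \<le> C"
    using assms[THEN simple_calculus_bounded] by auto
  then have "\<bar>g l * h l\<bar> \<le> B * C" for l
    unfolding abs_mult by (meson mult_mono abs_ge_zero order_trans)
  then show "\<exists>B. \<forall>l. \<bar>g l * h l\<bar> \<le> B" by blast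
qed (use assms[THEN simple_calculus_measurable] in auto)

lemma integrable_simple_calculus_indicator:
  assumes "simple_calculus E x g y" "S \<in> sets borel"
  shows "integrable (scalar_measure E w) (\<lambda>l. g l * indicator S l)"
  using assms integrable_simple_calculus
  by (intro integrable_real_mult_indicator) (auto simp: sets_scalar_measure)

lemma simple_calculus_inner_pvm:
  assumes "simple_calculus E x g y" "S \<in> sets borel"
  shows "inner y (E S x) = (\<integral>l. g l * indicator S l \<partial>scalar_measure E x)"
  using assms(1)
proof (induction rule: simple_calculus.induct)
  case zero
  then show ?case by simp
next
  case (step g y T a)
  have "(\<integral>l. (g l + a * indicator T l) * indicator S l \<partial>scalar_measure E x)
      = (\<integral>l. g l * indicator S l + a * indicator (T \<inter> S) l \<partial>scalar_measure E x)"
    by (rule Bochner_Integration.integral_cong) (auto simp: indicator_def)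
  also have "\<dots> = inner y (E S x) + a * measure (scalar_measure E x) (T \<inter> S)"
    using step assms(2) integrable_simple_calculus_indicator[OF step(1) assms(2)]
    by (subst Bochner_Integration.integral_add)
      (auto simp: sets_scalar_measure space_scalar_measure integrable_indicator)
  also have "\<dots> = inner (y + a *\<^sub>R E T x) (E S x)"
    using step(2) assms(2)
    by (simp add: inner_add_left measure_scalar_measure pvm_inner flip: pvm_inner_self)
  finally show ?case ..
qed

text \<open>On indicator functions this is \<open>\<langle>E S x, E T x\<rangle> = \<langle>E (S \<inter> T) x, x\<rangle>\<close>, and both sides are bilinear.
  It makes \<open>g \<mapsto> g(E) x\<close> an isometry from \<open>L\<^sup>2\<close> of the measure of \<open>x\<close> into the Hilbert space, so that
  it extends to all square-integrable functions.\<close>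

lemma simple_calculus_inner:
  assumes "simple_calculus E x g y" "simple_calculus E x h z"
  shows "inner y z = (\<integral>l. g l * h l \<partial>scalar_measure E x)"
  using assms(2)
proof (induction rule: simple_calculus.induct)
  case zero
  then show ?case by simp
next
  case (step h z S a)
  have "(\<integral>l. g l * (h l + a * indicator S l) \<partial>scalar_measure E x)
      = (\<integral>l. g l * h l + a * (g l * indicator S l) \<partial>scalar_measure E x)"
    by (simp add: algebra_simps)
  also have "\<dots> = inner y z + a * inner y (E S x)"
    using step integrable_simple_calculus_indicator[OF assms(1) step(2)]
      integrable_simple_calculus_mult[OF assms(1) step(1)]
    by (simp add: simple_calculus_inner_pvm[OF assms(1) step(2)])
  finally show ?case
    by (simp add: inner_add_right)
qed

lemma simple_calculus_norm_diff:
  assumes g: "simple_calculus E x g y" and h: "simple_calculus E x h z"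
  shows "(norm (y - z))\<^sup>2 = (\<integral>l. (g l - h l)\<^sup>2 \<partial>scalar_measure E x)"
proof -
  have "(\<integral>l. (g l - h l)\<^sup>2 \<partial>scalar_measure E x)
      = (\<integral>l. g l * g l - 2 * (g l * h l) + h l * h l \<partial>scalar_measure E x)"
    by (simp add: power2_eq_square algebra_simps)
  also have "\<dots> = inner y y - 2 * inner y z + inner z z"
    using integrable_simple_calculus_mult[OF g g] integrable_simple_calculus_mult[OF g h]
      integrable_simple_calculus_mult[OF h h]
    by (simp add: simple_calculus_inner[OF g g] simple_calculus_inner[OF g h] simple_calculus_inner[OF h h])
  finally show ?thesis
    by (simp add: power2_norm_eq_inner inner_diff_left inner_diff_right inner_commute)
qed

text \<open>For an indicator function this is the polarization identity of the quadratic form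
  \<open>x \<mapsto> |E S x|\<^sup>2\<close>. In this form the identity characterizes spectral integrals.\<close>

lemma simple_calculus_polarization:
  assumes "simple_calculus E x g y"
  shows "inner y z = ((\<integral>l. g l \<partial>scalar_measure E (x + z)) - (\<integral>l. g l \<partial>scalar_measure E (x - z))) / 4"
  using assms
proof (induction rule: simple_calculus.induct)
  case zero
  then show ?case by simp
next
  case (step g y S a)
  have int: "(\<integral>l. g l + a * indicator S l \<partial>scalar_measure E w)
      = (\<integral>l. g l \<partial>scalar_measure E w) + a * (norm (E S w))\<^sup>2" for w
    using step integrable_simple_calculus[OF step(1)]
    by (subst Bochner_Integration.integral_add)
      (auto simp: measure_scalar_measure space_scalar_measure integrable_indicator)
  interpret bounded_linear "E S" by (rule bounded_linear_pvm[OF step(2)])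
  have "inner (E S x) z = inner (E S x) (E S z)"
    using pvm_inner[OF step(2) step(2)] by simp
  then have "4 * inner (E S x) z = (norm (E S (x + z)))\<^sup>2 - (norm (E S (x - z)))\<^sup>2"
    by (simp add: add diff power2_norm_eq_inner inner_add_left inner_add_right inner_diff_left inner_diff_right inner_commute)
  then have "4 * (a * inner (E S x) z)
      = a * (norm (E S (x + z)))\<^sup>2 - a * (norm (E S (x - z)))\<^sup>2"
    by (metis mult.left_commute right_diff_distrib)
  with step.IH show ?case
    by (simp add: int inner_add_left field_simps)
qed

text \<open>Simple functions \<open>s n \<rightarrow> f\<close> with \<open>|s n| \<le> 2|f|\<close> converge in \<open>L\<^sup>2\<close> of the measure of
  \<open>x\<close>, so the vectors \<open>(s n)(E) x\<close> form a Cauchy sequence, and all identities pass to its limit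
  by dominated convergence.\<close>

lemma functional_calculus_exists:
  assumes f: "f \<in> borel_measurable borel" and x: "x \<in> spectral_domain E f"
  shows "\<exists>y. (\<forall>z\<in>spectral_domain E f. inner y z =
      ((\<integral>l. f l \<partial>scalar_measure E (x + z)) - (\<integral>l. f l \<partial>scalar_measure E (x - z))) / 4) \<and>
    (norm y)\<^sup>2 = (\<integral>l. (f l)\<^sup>2 \<partial>scalar_measure E x) \<and>
    inner y x = (\<integral>l. f l \<partial>scalar_measure E x)"
proof -
  obtain s where s: "\<And>n. simple_function borel (s n)" "\<And>l. (\<lambda>n. s n l) \<longlonglongrightarrow> f l"
      "\<And>n l. \<bar>s n l\<bar> \<le> 2 * \<bar>f l\<bar>"
    using borel_measurable_implies_sequence_metric[OF f, of 0] by (auto simp: dist_norm)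
  have "\<forall>n. \<exists>y. simple_calculus E x (s n) y"
    using simple_calculus_exists s(1) by blast
  then obtain y where y: "\<And>n. simple_calculus E x (s n) (y n)"
    by metis
  have s_meas [measurable]: "s n \<in> borel_measurable borel" for n
    by (rule simple_calculus_measurable[OF y])
  note f [measurable] and meas = measurable_scalar_measure
  have f2: "integrable (scalar_measure E x) (\<lambda>l. (f l)\<^sup>2)"
    by (rule integrable_square_spectral_domain[OF f x])
  have s2: "(s n l)\<^sup>2 \<le> 4 * (f l)\<^sup>2" for n l
    using power_mono[OF s(3)[of n l] abs_ge_zero, of 2] by (simp add: power_mult_distrib)
  have sf2: "(s n l - f l)\<^sup>2 \<le> 9 * (f l)\<^sup>2" for n l
  proof -
    have "\<bar>s n l - f l\<bar> \<le> 3 * \<bar>f l\<bar>"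
      using s(3)[of n l] by simp
    from power_mono[OF this abs_ge_zero, of 2] show ?thesis
      by (simp add: power_mult_distrib)
  qed
  have int_sf2: "integrable (scalar_measure E x) (\<lambda>l. (s n l - f l)\<^sup>2)" for n
    by (rule Bochner_Integration.integrable_bound[OF integrable_mult_right[OF f2, of 9]])
      (auto simp: meas sf2)
  define \<delta> where "\<delta> n = (\<integral>l. (s n l - f l)\<^sup>2 \<partial>scalar_measure E x)" for n
  have \<delta>: "\<delta> \<longlonglongrightarrow> 0"
  proof -
    have "(\<lambda>n. \<integral>l. (s n l - f l)\<^sup>2 \<partial>scalar_measure E x)
        \<longlonglongrightarrow> (\<integral>l. 0 \<partial>scalar_measure E x)"
    proof (rule integral_dominated_convergence[where w = "\<lambda>l. 9 * (f l)\<^sup>2"])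
      show "AE l in scalar_measure E x. (\<lambda>n. (s n l - f l)\<^sup>2) \<longlonglongrightarrow> 0"
        using s(2) by (intro always_eventually allI tendsto_eq_intros) (auto intro: tendsto_eq_intros)
    qed (use f2 sf2 in \<open>auto simp: meas\<close>)
    then show ?thesis
      by (simp add: \<delta>_def [abs_def])
  qed
  have "Cauchy y"
  proof (rule CauchyI)
    fix e :: real
    assume e: "0 < e"
    then have "eventually (\<lambda>n. \<delta> n < e\<^sup>2 / 4) sequentially"
      using \<delta> by (intro order_tendstoD(2)) auto
    then obtain N where N: "\<And>n. n \<ge> N \<Longrightarrow> \<delta> n < e\<^sup>2 / 4"
      by (auto simp: eventually_sequentially)
    have "norm (y m - y n) < e" if "m \<ge> N" "n \<ge> N" for m n
    proof -
      have "(norm (y m - y n))\<^sup>2 = (\<integral>l. (s m l - s n l)\<^sup>2 \<partial>scalar_measure E x)"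
        by (rule simple_calculus_norm_diff[OF y y])
      also have "\<dots> \<le> (\<integral>l. 2 * (s m l - f l)\<^sup>2 + 2 * (s n l - f l)\<^sup>2 \<partial>scalar_measure E x)"
      proof (rule integral_mono')
        show "integrable (scalar_measure E x) (\<lambda>l. 2 * (s m l - f l)\<^sup>2 + 2 * (s n l - f l)\<^sup>2)"
          using int_sf2 by simp
        fix l
        have "0 \<le> ((s m l - f l) + (s n l - f l))\<^sup>2" by simp
        then show "(s m l - s n l)\<^sup>2 \<le> 2 * (s m l - f l)\<^sup>2 + 2 * (s n l - f l)\<^sup>2"
          by (simp add: power2_eq_square algebra_simps)
      qed simp
      also have "\<dots> = 2 * \<delta> m + 2 * \<delta> n"
        using int_sf2 by (simp add: \<delta>_def)
      also have "\<dots> < e\<^sup>2"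
        using N[OF that(1)] N[OF that(2)] by simp
      finally show ?thesis
        using e by (simp add: power_less_imp_less_base)
    qed
    then show "\<exists>N. \<forall>m\<ge>N. \<forall>n\<ge>N. norm (y m - y n) < e" by blast
  qed
  then obtain Y where Y: "y \<longlonglongrightarrow> Y"
    using Cauchy_convergent convergent_def by blast
  have lim1: "(\<lambda>n. \<integral>l. s n l \<partial>scalar_measure E w) \<longlonglongrightarrow> (\<integral>l. f l \<partial>scalar_measure E w)"
    if "w \<in> spectral_domain E f" for w
  proof (rule integral_dominated_convergence[where w = "\<lambda>l. 2 * \<bar>f l\<bar>"])
    show "integrable (scalar_measure E w) (\<lambda>l. 2 * \<bar>f l\<bar>)"
      using integrable_spectral_domain[OF f that] by simp
  qed (use s in \<open>auto simp: meas\<close>)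
  have lim2: "(\<lambda>n. \<integral>l. (s n l)\<^sup>2 \<partial>scalar_measure E x) \<longlonglongrightarrow> (\<integral>l. (f l)\<^sup>2 \<partial>scalar_measure E x)"
  proof (rule integral_dominated_convergence[where w = "\<lambda>l. 4 * (f l)\<^sup>2"])
    show "AE l in scalar_measure E x. (\<lambda>n. (s n l)\<^sup>2) \<longlonglongrightarrow> (f l)\<^sup>2"
      using s(2) by (intro always_eventually allI tendsto_intros)
  qed (use f2 s2 in \<open>auto simp: meas\<close>)
  have one: "simple_calculus E x (\<lambda>_. 1) x"
    using simple_calculus.step[OF simple_calculus.zero, of UNIV E x 1] by (simp add: pvm_UNIV)
  show ?thesis
  proof (intro exI[of _ Y] conjI ballI)
    fix z
    assume z: "z \<in> spectral_domain E f"
    have "(\<lambda>n. inner (y n) z) \<longlonglongrightarrow>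
        ((\<integral>l. f l \<partial>scalar_measure E (x + z)) - (\<integral>l. f l \<partial>scalar_measure E (x - z))) / 4"
      unfolding simple_calculus_polarization[OF y]
      by (intro tendsto_intros lim1 spectral_domain_add[OF f] spectral_domain_diff[OF f] x z) simp
    moreover have "(\<lambda>n. inner (y n) z) \<longlonglongrightarrow> inner Y z"
      by (intro tendsto_intros Y)
    ultimately show "inner Y z =
        ((\<integral>l. f l \<partial>scalar_measure E (x + z)) - (\<integral>l. f l \<partial>scalar_measure E (x - z))) / 4"
      using LIMSEQ_unique by blast
  next
    have "(\<lambda>n. (norm (y n))\<^sup>2) \<longlonglongrightarrow> (norm Y)\<^sup>2"
      by (intro tendsto_intros Y)
    moreover have "(\<lambda>n. (norm (y n))\<^sup>2) \<longlonglongrightarrow> (\<integral>l. (f l)\<^sup>2 \<partial>scalar_measure E x)"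
      using lim2
      unfolding power2_norm_eq_inner simple_calculus_inner[OF y y] by (simp add: power2_eq_square)
    ultimately show "(norm Y)\<^sup>2 = (\<integral>l. (f l)\<^sup>2 \<partial>scalar_measure E x)"
      by (rule LIMSEQ_unique)
  next
    have "(\<lambda>n. inner (y n) x) \<longlonglongrightarrow> inner Y x"
      by (intro tendsto_intros Y)
    moreover have "(\<lambda>n. inner (y n) x) \<longlonglongrightarrow> (\<integral>l. f l \<partial>scalar_measure E x)"
      using lim1[OF x] by (simp add: simple_calculus_inner[OF y one])
    ultimately show "inner Y x = (\<integral>l. f l \<partial>scalar_measure E x)"
      by (rule LIMSEQ_unique)
  qed
qed

text \<open>The sets on which \<open>k \<le> |f| < k + 1\<close> partition the line into countably many Borel pieces with
  \<open>f\<close> bounded on each, so that every vector is a sum of vectors in the domain of \<open>f(E)\<close>.\<close>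

lemma pvm_sums_level_sets:
  assumes [measurable]: "f \<in> borel_measurable borel" "S \<in> sets borel"
  shows "S \<inter> {l. nat \<lfloor>\<bar>f l :: real\<bar>\<rfloor> = k} \<in> sets borel"
    and "(\<lambda>k. E (S \<inter> {l. nat \<lfloor>\<bar>f l :: real\<bar>\<rfloor> = k}) x) sums E S x"
proof -
  have borel: "S \<inter> {l. nat \<lfloor>\<bar>f l :: real\<bar>\<rfloor> = k} \<in> sets borel" for k
  proof (rule sets.Int)
    have "Measurable.pred borel (\<lambda>l. nat \<lfloor>\<bar>f l\<bar>\<rfloor> = k)"
      by measurable
    then show "{l. nat \<lfloor>\<bar>f l :: real\<bar>\<rfloor> = k} \<in> sets borel"
      by (simp add: pred_def)
  qed fact
  then show "S \<inter> {l. nat \<lfloor>\<bar>f l :: real\<bar>\<rfloor> = k} \<in> sets borel" .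
  have "(\<lambda>k. E (S \<inter> {l. nat \<lfloor>\<bar>f l\<bar>\<rfloor> = k}) x) sums E (\<Union>k. S \<inter> {l. nat \<lfloor>\<bar>f l\<bar>\<rfloor> = k}) x"
    using borel by (intro pvm_sums) (blast, auto simp: disjoint_family_on_def)
  moreover have "(\<Union>k. S \<inter> {l. nat \<lfloor>\<bar>f l\<bar>\<rfloor> = k}) = S"
    by auto
  ultimately show "(\<lambda>k. E (S \<inter> {l. nat \<lfloor>\<bar>f l\<bar>\<rfloor> = k}) x) sums E S x"
    by (simp only:)
qed

lemma pvm_level_set_in_spectral_domain:
  assumes "f \<in> borel_measurable borel" "S \<in> sets borel"
  shows "E (S \<inter> {l. nat \<lfloor>\<bar>f l\<bar>\<rfloor> = k}) x \<in> spectral_domain E f"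
proof (rule pvm_in_spectral_domain[OF assms(1) pvm_sums_level_sets(1)[OF assms]])
  fix l
  assume "l \<in> S \<inter> {l. nat \<lfloor>\<bar>f l\<bar>\<rfloor> = k}"
  then have "\<lfloor>\<bar>f l\<bar>\<rfloor> = int k" by auto
  then show "\<bar>f l\<bar> \<le> real k + 1" by linarith
qed

text \<open>The difference \<open>y - y'\<close> is orthogonal to each of its own components on the level sets of \<open>f\<close>,
  and it is the sum of these. This is the uniqueness that makes the definite description of the
  spectral integral meaningful.\<close>

lemma eq_if_inner_eq_on_spectral_domain:
  assumes f: "f \<in> borel_measurable borel"
    and eq: "\<And>z. z \<in> spectral_domain E f \<Longrightarrow> inner y z = inner y' z"
  shows "y = y'"
proof -
  let ?z = "\<lambda>k. E (UNIV \<inter> {l. nat \<lfloor>\<bar>f l\<bar>\<rfloor> = k}) (y - y')"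
  have "(\<lambda>k. inner (y - y') (?z k)) sums inner (y - y') (E UNIV (y - y'))"
    by (intro bounded_linear.sums[OF bounded_linear_inner_right] pvm_sums_level_sets(2) f) simp
  moreover have "inner (y - y') (?z k) = 0" for k
    unfolding inner_diff_left by (subst eq[OF pvm_level_set_in_spectral_domain[OF f]]) simp_all
  ultimately have "inner (y - y') (y - y') = 0"
    by (simp add: pvm_UNIV sums_iff)
  then show ?thesis by simp
qed

lemma
  assumes f: "f \<in> borel_measurable borel" and x: "x \<in> spectral_domain E f"
  shows norm_spectral_integral:
      "(norm (spectral_integral E f x))\<^sup>2 = (\<integral>l. (f l)\<^sup>2 \<partial>scalar_measure E x)"
    and inner_spectral_integral:
      "inner (spectral_integral E f x) x = (\<integral>l. f l \<partial>scalar_measure E x)"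
proof -
  obtain y where y: "\<forall>z\<in>spectral_domain E f. inner y z =
        ((\<integral>l. f l \<partial>scalar_measure E (x + z)) - (\<integral>l. f l \<partial>scalar_measure E (x - z))) / 4"
      "(norm y)\<^sup>2 = (\<integral>l. (f l)\<^sup>2 \<partial>scalar_measure E x)"
      "inner y x = (\<integral>l. f l \<partial>scalar_measure E x)"
    using functional_calculus_exists[OF f x] by blast
  have "spectral_integral E f x = y"
    unfolding spectral_integral_def
  proof (rule the_equality, rule y(1))
    fix y'
    assume y': "\<forall>z\<in>spectral_domain E f. inner y' z =
        ((\<integral>l. f l \<partial>scalar_measure E (x + z)) - (\<integral>l. f l \<partial>scalar_measure E (x - z))) / 4"
    show "y' = y"
      by (rule eq_if_inner_eq_on_spectral_domain[OF f]) (simp only: y(1)[rule_format] y'[rule_format])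
  qed
  with y show "(norm (spectral_integral E f x))\<^sup>2 = (\<integral>l. (f l)\<^sup>2 \<partial>scalar_measure E x)"
    "inner (spectral_integral E f x) x = (\<integral>l. f l \<partial>scalar_measure E x)"
    by simp_all
qed

end

section \<open>The quadratic form of a coercive operator\<close>

lemma inner_operator_eq_integral:
  fixes D :: "'a::{real_inner, complete_space} set"
  assumes "spectral_measure_of D A E" "x \<in> D"
  shows "inner (A x) x = (\<integral>l. l \<partial>scalar_measure E x)"
  using assms inner_spectral_integral[of E "\<lambda>l. l" x] by (simp add: spectral_measure_of_def)

text \<open>A vector \<open>w\<close> in the range of \<open>E S\<close>, with \<open>S\<close> a bounded set of negative numbers,
  satisfies \<open>\<langle>A w, w\<rangle> \<le> 0\<close>; coercivity makes it vanish.\<close>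

lemma coercive_pvm_negative:
  fixes D :: "'a::{real_inner, complete_space} set"
  assumes spec: "spectral_measure_of D A E"
    and c: "c > 0" and coercive: "\<And>x. x \<in> D \<Longrightarrow> c * (norm x)\<^sup>2 \<le> inner (A x) x"
  shows "E {..<0} x = 0"
proof -
  have E: "projection_valued_measure E" and D: "D = spectral_domain E (\<lambda>l. l)"
    using spec by (auto simp: spectral_measure_of_def)
  have "E ({..<0} \<inter> {l. nat \<lfloor>\<bar>l\<bar>\<rfloor> = k}) x = 0" for k
  proof -
    let ?S = "{..<0} \<inter> {l::real. nat \<lfloor>\<bar>l\<bar>\<rfloor> = k}"
    let ?w = "E ?S x"
    have S: "?S \<in> sets borel"
      by (rule pvm_sums_level_sets(1)[OF E]) auto
    have w: "?w \<in> D"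
      unfolding D by (rule pvm_level_set_in_spectral_domain[OF E]) auto
    have "{l::real. \<not> l \<le> 0} \<inter> ?S = {}" by auto
    then have "AE l in scalar_measure E ?w. l \<le> 0"
      using pvm_Int[OF E _ S, of "{l. \<not> l \<le> 0}" x] pvm_empty[OF E]
      by (intro AE_scalar_measure[OF E]) (auto simp flip: greaterThan_def simp: not_le)
    then have "(\<integral>l. - l \<partial>scalar_measure E ?w) \<ge> 0"
      by (intro integral_nonneg_AE) auto
    then have "inner (A ?w) ?w \<le> 0"
      by (simp add: inner_operator_eq_integral[OF spec w])
    then have "c * (norm ?w)\<^sup>2 \<le> 0"
      using coercive[OF w] by simp
    then show ?thesis
      using c by (simp add: mult_le_0_iff)
  qed
  then show ?thesis
    using pvm_sums_level_sets(2)[OF E, of "\<lambda>l. l" "{..<0}" x] by (simp add: sums_iff)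
qed

text \<open>The real function \<open>sqrt\<close> is odd, hence \<open>(sqrt l)\<^sup>2 = |l|\<close> for all real \<open>l\<close>. This is integrable
  whenever \<open>l\<^sup>2\<close> is, so the domain of \<open>A\<close> lies in that of its square root; and it equals \<open>l\<close> almost
  everywhere because the negative half-line is a null set.\<close>

lemma norm_sqrt_op:
  fixes D :: "'a::{real_inner, complete_space} set"
  assumes spec: "spectral_measure_of D A E"
    and c: "c > 0" and coercive: "\<And>x. x \<in> D \<Longrightarrow> c * (norm x)\<^sup>2 \<le> inner (A x) x"
    and x: "x \<in> D"
  shows "(norm (sqrt_op E x))\<^sup>2 = inner (A x) x"
proof -
  have E: "projection_valued_measure E" and D: "D = spectral_domain E (\<lambda>l. l)"
    using spec by (auto simp: spectral_measure_of_def)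
  have sqrt_meas: "sqrt \<in> borel_measurable borel"
    by (intro borel_measurable_continuous_onI continuous_intros)
  have id_meas: "(\<lambda>l::real. l) \<in> borel_measurable borel"
    by simp
  have sq: "(sqrt l)\<^sup>2 = \<bar>l\<bar>" for l
    by (metis power2_abs real_sqrt_abs2 real_sqrt_mult real_sqrt_power power2_eq_square)
  have "(\<integral>\<^sup>+ l. ennreal ((sqrt l)\<^sup>2) \<partial>scalar_measure E x) < \<infinity>"
    using integrable_spectral_domain[OF E id_meas] x
    by (simp add: sq D integrable_iff_bounded)
  then have "x \<in> spectral_domain E sqrt"
    by (simp add: spectral_domain_def)
  then have "(norm (sqrt_op E x))\<^sup>2 = (\<integral>l. \<bar>l\<bar> \<partial>scalar_measure E x)"
    by (simp add: sqrt_op_def norm_spectral_integral[OF E sqrt_meas] sq)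
  also have "\<dots> = (\<integral>l. l \<partial>scalar_measure E x)"
  proof (rule integral_cong_AE)
    have "AE l in scalar_measure E x. 0 \<le> l"
      using coercive_pvm_negative[OF spec c coercive]
      by (intro AE_scalar_measure[OF E]) (auto simp: not_le simp flip: atLeast_def lessThan_def)
    then show "AE l in scalar_measure E x. \<bar>l\<bar> = l"
      by eventually_elim simp
  qed (auto simp: measurable_scalar_measure[OF E])
  finally show ?thesis
    by (simp add: inner_operator_eq_integral[OF spec x])
qed

section \<open>Differentiating the quadratic form along a curve\<close>

lemma self_adjoint_symmetric:
  assumes "self_adjoint_operator D A" "x \<in> D" "y \<in> D"
  shows "inner (A x) y = inner x (A y)"
proof -
  have "(y, A y) \<in> adjoint_graph D A"
    using assms by (auto simp: self_adjoint_operator_def)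
  then show ?thesis
    using assms(2) by (simp add: adjoint_graph_def)
qed

lemma self_adjoint_diff:
  assumes "self_adjoint_operator D A" "x \<in> D" "y \<in> D"
  shows "A (x - y) = A x - A y"
proof -
  have D: "subspace D" and add: "\<And>x y. x \<in> D \<Longrightarrow> y \<in> D \<Longrightarrow> A (x + y) = A x + A y"
    using assms(1) by (auto simp: self_adjoint_operator_def densely_defined_operator_def)
  have "A ((x - y) + y) = A (x - y) + A y"
    using D assms by (intro add) (auto simp: subspace_diff)
  then show ?thesis by simp
qed

lemma C0_graph_tendsto:
  assumes A: "self_adjoint_operator D A" and f: "C0_graph D A I f" and t: "t \<in> I"
  shows "((\<lambda>s. A (f s)) \<longlongrightarrow> A (f t)) (at t within I)"
proof -
  have lim: "((\<lambda>s. graph_norm A (f s - f t)) \<longlongrightarrow> 0) (at t within I)"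
    and D: "\<And>s. s \<in> I \<Longrightarrow> f s \<in> D"
    using f t by (auto simp: C0_graph_def)
  have "((\<lambda>s. A (f s) - A (f t)) \<longlongrightarrow> 0) (at t within I)"
  proof (rule Lim_null_comparison[OF _ lim])
    have "norm (A (f s) - A (f t)) \<le> graph_norm A (f s - f t)" if "s \<in> I" for s
      unfolding graph_norm_def self_adjoint_diff[OF A D[OF that] D[OF t]]
      by (rule real_le_rsqrt) simp
    then show "eventually (\<lambda>s. norm (A (f s) - A (f t)) \<le> graph_norm A (f s - f t)) (at t within I)"
      by (auto simp: eventually_at_filter)
  qed
  then show ?thesis
    by (rule LIM_zero_cancel)
qed

lemma has_vector_derivative_quotient:
  assumes "(f has_vector_derivative f') (at t within I)"
  shows "((\<lambda>s. (f s - f t) /\<^sub>R (s - t)) \<longlongrightarrow> f') (at t within I)"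
proof -
  have "((\<lambda>s. norm ((f s - f t) - (s - t) *\<^sub>R f') / norm (s - t)) \<longlongrightarrow> 0) (at t within I)"
    using assms by (simp add: has_vector_derivative_def has_derivative_iff_norm)
  moreover have "norm ((f s - f t) - (s - t) *\<^sub>R f') / norm (s - t) = norm ((f s - f t) /\<^sub>R (s - t) - f')"
    if "s \<noteq> t" for s
  proof -
    have "(f s - f t) /\<^sub>R (s - t) - f' = ((f s - f t) - (s - t) *\<^sub>R f') /\<^sub>R (s - t)"
      using that by (simp add: scaleR_right_diff_distrib)
    then show ?thesis
      by (simp add: divide_inverse mult.commute)
  qed
  then have "eventually (\<lambda>s. norm ((f s - f t) - (s - t) *\<^sub>R f') / norm (s - t)
      = norm ((f s - f t) /\<^sub>R (s - t) - f')) (at t within I)"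
    by (auto simp: eventually_at_filter)
  ultimately have "((\<lambda>s. norm ((f s - f t) /\<^sub>R (s - t) - f')) \<longlongrightarrow> 0) (at t within I)"
    by (rule Lim_transform_eventually)
  then show ?thesis
    by (rule LIM_zero_cancel[OF tendsto_norm_zero_cancel])
qed

text \<open>Although \<open>A\<close> may be unbounded and \<open>f\<close> is differentiable only in the norm of the space, symmetry gives
  \<open>\<langle>A f(s), f(s)\<rangle> - \<langle>A f(t), f(t)\<rangle> = \<langle>A f(s) + A f(t), f(s) - f(t)\<rangle>\<close>: no increment of
  \<open>A f\<close> has to be divided by \<open>s - t\<close>, and continuity of \<open>A f\<close> suffices.\<close>

lemma quadratic_form_has_derivative:
  assumes A: "self_adjoint_operator D A" and f: "C0_graph D A I f" and t: "t \<in> I"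
    and f': "(f has_vector_derivative f') (at t within I)"
  shows "((\<lambda>s. inner (A (f s)) (f s)) has_real_derivative 2 * inner (A (f t)) f') (at t within I)"
proof -
  have D: "\<And>s. s \<in> I \<Longrightarrow> f s \<in> D"
    using f by (auto simp: C0_graph_def)
  have "((\<lambda>s. inner (A (f s) + A (f t)) ((f s - f t) /\<^sub>R (s - t)))
      \<longlongrightarrow> inner (A (f t) + A (f t)) f') (at t within I)"
    by (intro tendsto_intros C0_graph_tendsto[OF A f t] has_vector_derivative_quotient[OF f'])
  moreover have "inner (A (f s) + A (f t)) ((f s - f t) /\<^sub>R (s - t))
      = (inner (A (f s)) (f s) - inner (A (f t)) (f t)) / (s - t)" if "s \<in> I" for s
  proof -
    have "inner (A (f s)) (f t) = inner (A (f t)) (f s)"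
      using self_adjoint_symmetric[OF A D[OF that] D[OF t]] by (simp add: inner_commute)
    then show ?thesis
      by (simp add: inner_add_left inner_diff_right divide_inverse mult.commute)
  qed
  then have "eventually (\<lambda>s. inner (A (f s) + A (f t)) ((f s - f t) /\<^sub>R (s - t))
      = (inner (A (f s)) (f s) - inner (A (f t)) (f t)) / (s - t)) (at t within I)"
    by (auto simp: eventually_at_filter)
  ultimately have "((\<lambda>s. (inner (A (f s)) (f s) - inner (A (f t)) (f t)) / (s - t))
      \<longlongrightarrow> inner (A (f t) + A (f t)) f') (at t within I)"
    by (rule Lim_transform_eventually)
  then show ?thesis
    by (simp add: has_field_derivative_iff inner_add_left)
qed

lemma norm_square_has_derivative:
  assumes "(f has_vector_derivative f') (at t within I)"
  shows "((\<lambda>s. (norm (f s))\<^sup>2) has_real_derivative 2 * inner f' (f t)) (at t within I)"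
proof -
  have "(f has_derivative (\<lambda>h. h *\<^sub>R f')) (at t within I)"
    using assms by (simp add: has_vector_derivative_def)
  from has_derivative_inner[OF this this] show ?thesis
    unfolding has_field_derivative_def power2_norm_eq_inner
    by (rule has_derivative_eq_rhs) (auto simp: inner_commute algebra_simps)
qed

section \<open>Comparison with the weight\<close>

lemma half_line_nondecreasing:
  fixes g g' :: "real \<Rightarrow> real"
  assumes g': "\<And>t. t \<ge> 0 \<Longrightarrow> (g has_real_derivative g' t) (at t within {0..})"
    and nonneg: "\<And>t. t \<ge> a \<Longrightarrow> 0 \<le> g' t" and st: "0 \<le> a" "a \<le> s" "s \<le> t"
  shows "g s \<le> g t"
proof (rule DERIV_nonneg_imp_increasing_open[OF st(3)])
  fix x
  assume x: "s < x"
  have "at x within {0..} = at x"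
    using x st by (intro at_within_interior) auto
  then show "\<exists>y. DERIV g x :> y \<and> 0 \<le> y"
    using g'[of x] nonneg[of x] x st by auto
next
  have "continuous_on {0..} g"
    using g' by (auto simp: continuous_on_eq_continuous_within intro: DERIV_continuous)
  then show "continuous_on {s..t} g"
    by (rule continuous_on_subset) (use st in auto)
qed

text \<open>The hypothesis on \<open>e'\<close> bounds the logarithmic derivative of \<open>e\<close> below by \<open>- k / (1 + t)\<^sup>p\<close>,
  while that of \<open>\<Phi>\<close> is eventually below \<open>- (k + 1) / (1 + t)\<^sup>p\<close>. Their difference is at least
  \<open>1 / (1 + t)\<^sup>p \<ge> 1 / (1 + t)\<close> because \<open>p \<le> 1\<close>, so \<open>e / \<Phi>\<close> grows at least
  linearly.\<close>

lemma weakly_damped_over_weight_at_top: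
  fixes e e' \<Phi> \<Phi>' :: "real \<Rightarrow> real"
  assumes p: "0 \<le> p" "p \<le> 1" and k: "0 \<le> k"
    and e': "\<And>t. t \<ge> 0 \<Longrightarrow> (e has_real_derivative e' t) (at t within {0..})"
    and lower: "\<And>t. t \<ge> 0 \<Longrightarrow> - k * (1 / (1 + t) powr p) * e t \<le> e' t"
    and nonneg: "\<And>t. t \<ge> 0 \<Longrightarrow> 0 \<le> e t" and pos0: "0 < e 0"
    and \<Phi>: "\<And>t. t \<ge> 0 \<Longrightarrow> 0 < \<Phi> t"
    and \<Phi>': "\<And>t. t \<ge> 0 \<Longrightarrow> (\<Phi> has_real_derivative \<Phi>' t) (at t within {0..})"
    and lim: "filterlim (\<lambda>t. (1 + t) powr p * (\<Phi>' t / \<Phi> t)) at_bot at_top"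
  shows "filterlim (\<lambda>t. e t / \<Phi> t) at_top at_top"
proof -
  define b where "b t = 1 / (1 + t) powr p" for t :: real
  have b: "0 < b t" "b t \<le> 1" "1 \<le> b t * (1 + t)" if "t \<ge> 0" for t
  proof -
    have "1 \<le> (1 + t) powr p" "(1 + t) powr p \<le> 1 + t"
      using that p powr_mono[of p 1 "1 + t"] by (auto simp: ge_one_powr_ge_zero)
    then show "0 < b t" "b t \<le> 1" "1 \<le> b t * (1 + t)"
      using that by (auto simp: b_def field_simps)
  qed
  have pos: "0 < e t" if t: "t \<ge> 0" for t
  proof -
    \<comment> \<open>Since \<open>b \<le> 1\<close>, the lower bound gives \<open>e' \<ge> - k e\<close>, so \<open>e\<close> decays at most exponentially.\<close>
    have "e 0 * exp (k * 0) \<le> e t * exp (k * t)"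
    proof (rule half_line_nondecreasing[where a = 0 and g = "\<lambda>s. e s * exp (k * s)"
          and g' = "\<lambda>s. e' s * exp (k * s) + e s * (k * exp (k * s))"])
      fix s :: real
      assume s: "s \<ge> 0"
      show "((\<lambda>s. e s * exp (k * s)) has_real_derivative e' s * exp (k * s) + e s * (k * exp (k * s)))
          (at s within {0..})"
        by (rule derivative_eq_intros e'[OF s] refl | simp)+
      have "k * b s * e s \<le> k * 1 * e s"
        using b[OF s] nonneg[OF s] k by (intro mult_right_mono mult_left_mono) auto
      then have "0 \<le> e' s + k * e s"
        using lower[OF s] by (simp add: b_def)
      then have "0 \<le> (e' s + k * e s) * exp (k * s)"
        by simp
      then show "0 \<le> e' s * exp (k * s) + e s * (k * exp (k * s))"
        by (simp add: algebra_simps)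
    qed (use t in auto)
    then have "0 < e t * exp (k * t)"
      using pos0 by simp
    then show ?thesis
      by (simp add: zero_less_mult_iff)
  qed
  have "eventually (\<lambda>t. (1 + t) powr p * (\<Phi>' t / \<Phi> t) \<le> - (k + 1)) at_top"
    using lim by (simp add: filterlim_at_bot)
  then obtain T0 where T0: "\<And>t. t \<ge> T0 \<Longrightarrow> (1 + t) powr p * (\<Phi>' t / \<Phi> t) \<le> - (k + 1)"
    by (auto simp: eventually_at_top_linorder)
  define T where "T = max 0 T0"
  have \<Phi>'_le: "\<Phi>' t \<le> - (k + 1) * b t * \<Phi> t" if "t \<ge> T" for t
  proof -
    have t: "t \<ge> 0" using that by (simp add: T_def)
    have "b t * ((1 + t) powr p * (\<Phi>' t / \<Phi> t)) \<le> b t * (- (k + 1))"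
      using T0[of t] that b[OF t] by (intro mult_left_mono) (auto simp: T_def)
    moreover have "b t * ((1 + t) powr p * (\<Phi>' t / \<Phi> t)) = \<Phi>' t / \<Phi> t"
      using t by (simp add: b_def)
    ultimately have "\<Phi>' t / \<Phi> t \<le> - (k + 1) * b t"
      by (simp only: mult.commute)
    then show ?thesis
      using \<Phi>[OF t] by (simp only: pos_divide_le_eq)
  qed
  \<comment> \<open>The extra factor \<open>1 + t\<close> encodes the expected linear growth of \<open>e / \<Phi>\<close>.\<close>
  define g where "g t = e t / (\<Phi> t * (1 + t))" for t
  define g' where "g' t = (e' t * (\<Phi> t * (1 + t)) - e t * (\<Phi>' t * (1 + t) + \<Phi> t))
      / (\<Phi> t * (1 + t))\<^sup>2" for t
  have g_deriv: "(g has_real_derivative g' t) (at t within {0..})" if t: "t \<ge> 0" for t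
    unfolding g_def [abs_def] g'_def using \<Phi>[OF t] t
    by (auto intro!: derivative_eq_intros e'[OF t] \<Phi>'[OF t] simp: power2_eq_square)
  have g'_nonneg: "0 \<le> g' t" if tT: "t \<ge> T" for t
  proof -
    have t: "t \<ge> 0" using tT by (simp add: T_def)
    have "- k * b t * e t * (\<Phi> t * (1 + t)) \<le> e' t * (\<Phi> t * (1 + t))"
      using lower[OF t] \<Phi>[OF t] t by (intro mult_right_mono) (auto simp: b_def)
    moreover have "e t * (\<Phi>' t * (1 + t)) \<le> e t * (- (k + 1) * b t * \<Phi> t * (1 + t))"
      using \<Phi>'_le[OF tT] nonneg[OF t] t by (intro mult_left_mono mult_right_mono) auto
    moreover have "0 \<le> e t * \<Phi> t * (b t * (1 + t) - 1)"
      using nonneg[OF t] \<Phi>[OF t] b(3)[OF t] by simp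
    ultimately have "0 \<le> e' t * (\<Phi> t * (1 + t)) - e t * (\<Phi>' t * (1 + t) + \<Phi> t)"
      by (simp add: algebra_simps)
    then show ?thesis
      by (simp add: g'_def)
  qed
  have T: "T \<ge> 0" by (simp add: T_def)
  have "0 < g T"
    using pos[OF T] \<Phi>[OF T] T by (simp add: g_def)
  then have "filterlim (\<lambda>t. g T * (1 + t)) at_top at_top"
    by (intro filterlim_tendsto_pos_mult_at_top[OF tendsto_const]
        filterlim_tendsto_add_at_top[OF tendsto_const] filterlim_ident)
  then show ?thesis
  proof (rule filterlim_at_top_mono)
    have "g T * (1 + t) \<le> e t / \<Phi> t" if t: "t \<ge> T" for t
    proof -
      have "g T \<le> g t"
        by (rule half_line_nondecreasing[OF g_deriv g'_nonneg T order_refl t])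
      then have "g T * (1 + t) \<le> g t * (1 + t)"
        using t T by (intro mult_right_mono) auto
      also have "\<dots> = e t / \<Phi> t"
        using t T by (simp add: g_def)
      finally show ?thesis .
    qed
    then show "eventually (\<lambda>t. g T * (1 + t) \<le> e t / \<Phi> t) at_top"
      by (auto simp: eventually_at_top_linorder)
  qed
qed

section \<open>The energy\<close>

lemma locally_lipschitz_continuous_on:
  fixes m :: "real \<Rightarrow> real"
  assumes "\<forall>x\<in>S. \<exists>r>0. \<exists>L. L-lipschitz_on (cball x r \<inter> S) m"
  shows "continuous_on S m"
  unfolding continuous_on_eq_continuous_within
proof
  fix x
  assume x: "x \<in> S"
  then obtain r L where r: "r > 0" and L: "L-lipschitz_on (cball x r \<inter> S) m"
    using assms by blast
  have "continuous (at x within cball x r \<inter> S) m"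
    using lipschitz_on_continuous_on[OF L] x r by (auto simp: continuous_on_eq_continuous_within)
  moreover have "at x within cball x r \<inter> S = at x within S"
    using r by (intro at_within_nhd[of x "ball x r"]) auto
  ultimately show "continuous (at x within S) m"
    by (simp add: continuous_within)
qed

lemma integral_from_0_has_derivative:
  fixes m :: "real \<Rightarrow> real"
  assumes "continuous_on {0..} m" "0 \<le> x"
  shows "((\<lambda>x. integral {0..x} m) has_real_derivative m x) (at x within {0..})"
proof -
  have "((\<lambda>x. integral {0..x} m) has_real_derivative m x) (at x within {0..x + 1})"
    using assms by (intro integral_has_real_derivative) (auto elim: continuous_on_subset)
  moreover have "at x within {0..x + 1} = at x within {0..}"
    by (rule at_within_nhd[of x "{..<x + 1}"]) auto
  ultimately show ?thesis by simp
qed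

lemma bounded_below_if_ereal_INF_pos:
  assumes "(INF x\<in>S. ereal (f x)) > 0"
  shows "\<exists>c>0. \<forall>x\<in>S. c \<le> f x"
proof -
  obtain c where c: "0 < ereal c" "ereal c < (INF x\<in>S. ereal (f x))"
    using ereal_dense2[OF assms] by blast
  have "c \<le> f x" if "x \<in> S" for x
    using less_INF_D[OF c(2) that] by simp
  then show ?thesis
    using c(1) by auto
qed

lemma coercive_on_domain:
  assumes A: "self_adjoint_operator D A" and c: "\<forall>x\<in>{x \<in> D. norm x = 1}. c \<le> inner (A x) x"
    and x: "x \<in> D"
  shows "c * (norm x)\<^sup>2 \<le> inner (A x) x"
proof (cases "x = 0")
  case True
  then show ?thesis by simp
next
  case False
  let ?y = "x /\<^sub>R norm x"
  have "?y \<in> D" "A ?y = A x /\<^sub>R norm x"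
    using A x by (auto simp: self_adjoint_operator_def densely_defined_operator_def subspace_scale)
  moreover have "norm ?y = 1"
    using False by simp
  ultimately have "c \<le> inner (A x /\<^sub>R norm x) ?y"
    using c by fastforce
  also have "\<dots> = inner (A x) x / (norm x)\<^sup>2"
    by (simp add: divide_inverse power2_eq_square)
  finally show ?thesis
    using False by (simp add: pos_le_divide_eq)
qed

theorem theorem2p4:
  fixes D :: "'a::{real_inner, complete_space} set"
    and A :: "'a \<Rightarrow> 'a"
    and E :: "real set \<Rightarrow> 'a \<Rightarrow> 'a"
    and u0 u1 :: 'a
    and p \<epsilon> :: real
    and m \<Phi> \<Phi>' :: "real \<Rightarrow> real"
    and u u' u'' :: "real \<Rightarrow> 'a"
  assumes A: "self_adjoint_operator D A"
    and E: "spectral_measure_of D A E"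
    and data: "(u0, u1) \<in> D \<times> sqrt_domain E"
    and p: "p \<in> {0..1}"
    and m_pos: "\<forall>\<sigma>\<ge>0. m \<sigma> > 0"
    and m_lip: "\<forall>\<sigma>\<ge>0. \<exists>r>0. \<exists>L. L-lipschitz_on (cball \<sigma> r \<inter> {0..}) m"
    and m_inf: "(INF \<sigma>\<in>{0..}. ereal (m \<sigma>)) > 0"
    and A_inf: "(INF x\<in>{x \<in> D. norm x = 1}. ereal (inner (A x) x)) > 0"
    and eps: "\<epsilon> > 0"
    and u_deriv: "\<forall>t\<ge>0. (u has_vector_derivative u' t) (at t within {0..})"
    and u'_deriv: "\<forall>t\<ge>0. (u' has_vector_derivative u'' t) (at t within {0..})"
    and u_C2: "continuous_on {0..} u''"
    and u_C1: "C1_graph (sqrt_domain E) (sqrt_op E) {0..} u"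
    and u_C0: "C0_graph D A {0..} u"
    and eqn: "\<forall>t\<ge>0. \<epsilon> *\<^sub>R u'' t + (1 / (1 + t) powr p) *\<^sub>R u' t
                + m ((norm (sqrt_op E (u t)))\<^sup>2) *\<^sub>R A (u t) = 0"
    and init: "u 0 = u0" "u' 0 = u1"
    and Phi_pos: "\<forall>t\<ge>0. \<Phi> t > 0"
    and Phi_deriv: "\<forall>t\<ge>0. (\<Phi> has_real_derivative \<Phi>' t) (at t within {0..})"
    and Phi_C1: "continuous_on {0..} \<Phi>'"
    and Phi_lim: "filterlim (\<lambda>t. (1 + t) powr p * (\<Phi>' t / \<Phi> t)) at_bot at_top"
    and nontrivial: "(u0, u1) \<noteq> (0, 0)"
  shows "filterlim
           (\<lambda>t. (\<epsilon> * (norm (u' t))\<^sup>2 + (norm (sqrt_op E (u t)))\<^sup>2) * (1 / \<Phi> t)) at_top at_top"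
proof -
  obtain c where c: "c > 0" "\<forall>x\<in>{x \<in> D. norm x = 1}. c \<le> inner (A x) x"
    using bounded_below_if_ereal_INF_pos[OF A_inf] by blast
  note coercive = coercive_on_domain[OF A c(2)]
  obtain \<mu> where \<mu>: "\<mu> > 0" "\<And>x. x \<ge> 0 \<Longrightarrow> \<mu> \<le> m x"
    using bounded_below_if_ereal_INF_pos[OF m_inf] by auto
  have m_cont: "continuous_on {0..} m"
    using m_lip by (intro locally_lipschitz_continuous_on) auto
  define M where "M x = integral {0..x} m" for x
  have M_deriv: "(M has_real_derivative m x) (at x within {0..})" if "x \<ge> 0" for x
    unfolding M_def [abs_def] by (rule integral_from_0_has_derivative[OF m_cont that])
  have m_int: "m integrable_on {0..x}" for x
    by (intro integrable_continuous_real continuous_on_subset[OF m_cont]) auto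
  have M_lower: "\<mu> * x \<le> M x" if "x \<ge> 0" for x
  proof -
    have "integral {0..x} (\<lambda>_. \<mu>) \<le> integral {0..x} m"
      by (intro integral_le m_int) (auto simp: \<mu>(2))
    then show ?thesis
      using that by (simp add: M_def mult.commute)
  qed

  define \<sigma> where "\<sigma> t = inner (A (u t)) (u t)" for t
  have uD: "u t \<in> D" if "t \<ge> 0" for t
    using u_C0 that by (auto simp: C0_graph_def)
  have \<sigma>: "(norm (sqrt_op E (u t)))\<^sup>2 = \<sigma> t" if "t \<ge> 0" for t
    unfolding \<sigma>_def by (rule norm_sqrt_op[OF E c(1) coercive uD[OF that]])
  have \<sigma>_nonneg: "0 \<le> \<sigma> t" if "t \<ge> 0" for t
    using \<sigma>[OF that] by (metis zero_le_power2)
  have \<sigma>_deriv: "(\<sigma> has_real_derivative 2 * inner (A (u t)) (u' t)) (at t within {0..})"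
    if "t \<ge> 0" for t
    unfolding \<sigma>_def [abs_def]
    by (rule quadratic_form_has_derivative[OF A u_C0]) (use that u_deriv in auto)

  define e where "e t = \<epsilon> * (norm (u' t))\<^sup>2 + M (\<sigma> t)" for t
  define e' where "e' t = - 2 * (1 / (1 + t) powr p) * (norm (u' t))\<^sup>2" for t
  have e_deriv: "(e has_real_derivative e' t) (at t within {0..})" if t: "t \<ge> 0" for t
  proof -
    have "((\<lambda>t. M (\<sigma> t)) has_real_derivative m (\<sigma> t) * (2 * inner (A (u t)) (u' t))) (at t within {0..})"
      using DERIV_image_chain[OF DERIV_subset[OF M_deriv] \<sigma>_deriv[OF t]] \<sigma>_nonneg t
      by (force simp: o_def)
    moreover have "((\<lambda>t. \<epsilon> * (norm (u' t))\<^sup>2) has_real_derivative \<epsilon> * (2 * inner (u'' t) (u' t))) (at t within {0..})"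
      using u'_deriv t by (intro DERIV_cmult norm_square_has_derivative) auto
    ultimately have "(e has_real_derivative
        \<epsilon> * (2 * inner (u'' t) (u' t)) + m (\<sigma> t) * (2 * inner (A (u t)) (u' t))) (at t within {0..})"
      unfolding e_def [abs_def] by (intro DERIV_add)
    moreover have "\<epsilon> * (2 * inner (u'' t) (u' t)) + m (\<sigma> t) * (2 * inner (A (u t)) (u' t)) = e' t"
    proof -
      \<comment> \<open>The energy identity: the equation paired with \<open>u'\<close>.\<close>
      have "\<epsilon> *\<^sub>R u'' t + (1 / (1 + t) powr p) *\<^sub>R u' t + m (\<sigma> t) *\<^sub>R A (u t) = 0"
        using eqn t \<sigma>[OF t] by auto
      from arg_cong[OF this, of "\<lambda>x. inner x (u' t)"]
      have "\<epsilon> * inner (u'' t) (u' t) + (1 / (1 + t) powr p) * (norm (u' t))\<^sup>2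
          + m (\<sigma> t) * inner (A (u t)) (u' t) = 0"
        by (simp add: inner_add_left power2_norm_eq_inner)
      then show ?thesis
        unfolding e'_def by (simp add: algebra_simps)
    qed
    ultimately show ?thesis by simp
  qed
  have M_nonneg: "0 \<le> M (\<sigma> t)" if "t \<ge> 0" for t
  proof -
    have "0 \<le> \<mu> * \<sigma> t"
      using \<mu>(1) \<sigma>_nonneg[OF that] by simp
    also have "\<dots> \<le> M (\<sigma> t)"
      by (rule M_lower[OF \<sigma>_nonneg[OF that]])
    finally show ?thesis .
  qed
  have e_nonneg: "0 \<le> e t" if "t \<ge> 0" for t
    using M_nonneg[OF that] eps by (simp add: e_def)
  have e_lower: "- (2 / \<epsilon>) * (1 / (1 + t) powr p) * e t \<le> e' t" if t: "t \<ge> 0" for t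
  proof -
    have "0 \<le> M (\<sigma> t)"
      by (rule M_nonneg[OF t])
    then have "0 \<le> 2 / \<epsilon> * (1 / (1 + t) powr p) * M (\<sigma> t)"
      using eps by simp
    moreover have "2 / \<epsilon> * (1 / (1 + t) powr p) * e t
        = 2 * (1 / (1 + t) powr p) * (norm (u' t))\<^sup>2 + 2 / \<epsilon> * (1 / (1 + t) powr p) * M (\<sigma> t)"
      using eps by (simp add: e_def distrib_left)
    ultimately show ?thesis
      by (simp add: e'_def)
  qed
  have e_pos0: "0 < e 0"
  proof -
    have "0 < \<epsilon> * (norm u1)\<^sup>2 + \<mu> * (c * (norm u0)\<^sup>2)"
      using nontrivial eps \<mu>(1) c(1)
      by (cases "u1 = 0") (auto intro: add_pos_nonneg)
    also have "\<dots> \<le> \<epsilon> * (norm u1)\<^sup>2 + \<mu> * \<sigma> 0"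
      using coercive[OF uD[of 0]] \<mu>(1) by (simp add: \<sigma>_def init)
    also have "\<dots> \<le> e 0"
      using M_lower[OF \<sigma>_nonneg[of 0]] by (simp add: e_def init)
    finally show ?thesis .
  qed
  have ratio: "filterlim (\<lambda>t. e t / \<Phi> t) at_top at_top"
    by (rule weakly_damped_over_weight_at_top[where k = "2 / \<epsilon>", OF _ _ _ e_deriv e_lower e_nonneg e_pos0 _ _ Phi_lim])
      (use p eps Phi_pos Phi_deriv in auto)

  \<comment> \<open>The energy decreases, so \<open>\<sigma>\<close> stays in a compact set, on which \<open>M \<sigma> \<le> K \<sigma>\<close>.\<close>
  define R where "R = e 0 / \<mu>"
  have \<sigma>_le: "\<sigma> t \<le> R" if t: "t \<ge> 0" for t
  proof -
    have "- e 0 \<le> - e t"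
    proof (rule half_line_nondecreasing[where a = 0 and g = "\<lambda>s. - e s" and g' = "\<lambda>s. - e' s"])
      fix s :: real
      assume s: "s \<ge> 0"
      show "((\<lambda>s. - e s) has_real_derivative - e' s) (at s within {0..})"
        by (rule DERIV_minus[OF e_deriv[OF s]])
      show "0 \<le> - e' s"
        by (simp add: e'_def)
    qed (use t in auto)
    moreover have "\<mu> * \<sigma> t \<le> e t"
      using M_lower[OF \<sigma>_nonneg[OF t]] eps by (simp add: e_def add_increasing)
    ultimately have "\<mu> * \<sigma> t \<le> e 0" by linarith
    then show ?thesis
      using \<mu>(1) by (simp add: R_def field_simps)
  qed
  have "bdd_above (m ` {0..R})"
    by (intro bounded_imp_bdd_above compact_imp_bounded compact_continuous_image
        continuous_on_subset[OF m_cont]) auto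
  then obtain C where C: "m x \<le> C" if "x \<in> {0..R}" for x
    unfolding bdd_above_def by blast
  define K where "K = max 1 C"
  have e_upper: "e t \<le> K * (\<epsilon> * (norm (u' t))\<^sup>2 + \<sigma> t)" if t: "t \<ge> 0" for t
  proof -
    have "M (\<sigma> t) \<le> integral {0..\<sigma> t} (\<lambda>_. K)"
      unfolding M_def
    proof (intro integral_le m_int)
      fix x
      assume "x \<in> {0..\<sigma> t}"
      then have "m x \<le> C"
        using \<sigma>_le[OF t] by (intro C) simp
      then show "m x \<le> K" by (simp add: K_def)
    qed auto
    then have "M (\<sigma> t) \<le> K * \<sigma> t"
      using \<sigma>_nonneg[OF t] by (simp add: mult.commute)
    moreover have "1 * (\<epsilon> * (norm (u' t))\<^sup>2) \<le> K * (\<epsilon> * (norm (u' t))\<^sup>2)"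
      using eps by (intro mult_right_mono) (auto simp: K_def)
    ultimately show ?thesis
      by (simp add: e_def distrib_left)
  qed
  have K: "K > 0" by (simp add: K_def)
  then have "filterlim (\<lambda>t. 1 / K * (e t / \<Phi> t)) at_top at_top"
    by (intro filterlim_tendsto_pos_mult_at_top[OF tendsto_const _ ratio]) auto
  then show ?thesis
  proof (rule filterlim_at_top_mono)
    have "1 / K * (e t / \<Phi> t) \<le>
        (\<epsilon> * (norm (u' t))\<^sup>2 + (norm (sqrt_op E (u t)))\<^sup>2) * (1 / \<Phi> t)" if t: "t \<ge> 0" for t
    proof -
      have "e t / \<Phi> t \<le> K * (\<epsilon> * (norm (u' t))\<^sup>2 + \<sigma> t) / \<Phi> t"
        using e_upper[OF t] Phi_pos t by (intro divide_right_mono) (auto simp: less_imp_le)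
      then have "1 / K * (e t / \<Phi> t) \<le> 1 / K * (K * (\<epsilon> * (norm (u' t))\<^sup>2 + \<sigma> t) / \<Phi> t)"
        using K by (intro mult_left_mono) auto
      also have "\<dots> = (\<epsilon> * (norm (u' t))\<^sup>2 + \<sigma> t) * (1 / \<Phi> t)"
        using K by simp
      finally show ?thesis
        by (simp only: \<sigma>[OF t])
    qed
    then show "eventually (\<lambda>t. 1 / K * (e t / \<Phi> t) \<le>
        (\<epsilon> * (norm (u' t))\<^sup>2 + (norm (sqrt_op E (u t)))\<^sup>2) * (1 / \<Phi> t)) at_top"
      by (auto simp: eventually_at_top_linorder)
  qed
qed

end
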